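(* There is a root formula for which there is a tableau of HPL, having that formula as its root formula, with a branch of infinite length.
   Context: **Language.** Fix a countable set $\mathbf{Prop}$ of propositional variables and two disjoint countably infinite sets $\mathbf{Nom}_1$, $\mathbf{Nom}_2$ of nominals, disjoint from $\mathbf{Prop}$. Letters $i,j,k$ range over $\mathbf{Nom}_1$ and $a,b,c$ over $\mathbf{Nom}_2$. HPL formulas: $\varphi ::= p \mid i \mid a \mid \neg\varphi \mid \varphi\land\varphi \mid \diamondsuit_1\varphi \mid \diamondsuit_2\varphi \mid @_i\varphi \mid @_a\varphi$ with $p\in\mathbf{Prop}$. **Tableau.** A tableau is a tree (each node is reached from the root in finitely many steps; branches may be infinite) constructed as follows. Start with a root formula of the form $@_i@_a\psi$, where $i,a$ do not occur in $\psi$. Extend each branch by applying the rules below to all nodes as often as possible; no formula can be added to a branch any more if every new formula generated by applying an arbitrary rule already exists in the branch, or if the branch is closed. A branch is a maximal path; $\varphi\in\Theta$ means $\varphi$ occurs in the branch $\Theta$. Formulas already present in the branch are not added again. Rules (premises / formulas added to the branch; "$\mid$" means the branch splits): - $[\neg\neg]$: $@_i@_a\neg\neg\varphi\ /\ @_i@_a\varphi$. - $[\land]$: $@_i@_a(\varphi\land\psi)\ /\ @_i@_a\varphi,\ @_i@_a\psi$. - $[\neg\land]$: $@_i@_a\neg(\varphi\land\psi)\ /\ @_i@_a\neg\varphi\mid @_i@_a\neg\psi$. - $[\diamondsuit_1]$: $@_i@_a\diamondsuit_1\varphi\ /\ @_i\diamondsuit_1 j,\ @_j@_a\varphi$, where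 $j\in\mathbf{Nom}_1$ does not occur in the branch; applied only once per formula. - $[\diamondsuit_2]$: $@_i@_a\diamondsuit_2\varphi\ /\ @_a\diamondsuit_2 b,\ @_i@_b\varphi$, where $b\in\mathbf{Nom}_2$ does not occur in the branch; applied only once per formula. - $[\neg\diamondsuit_1]$: $@_i@_a\neg\diamondsuit_1\varphi,\ @_i\diamondsuit_1 j\ /\ @_j@_a\neg\varphi$. - $[\neg\diamondsuit_2]$: $@_i@_a\neg\diamondsuit_2\varphi,\ @_a\diamondsuit_2 b\ /\ @_i@_b\neg\varphi$. - $[@_1]$: $@_i@_a@_j\varphi\ /\ @_j@_a\varphi$. $[@_2]$: $@_i@_a@_b\varphi\ /\ @_i@_b\varphi$. - $[\neg@_1]$: $@_i@_a\neg@_j\varphi\ /\ @_j@_a\neg\varphi$. $[\neg@_2]$: $@_i@_a\neg@_b\varphi\ /\ @_i@_b\neg\varphi$. - $[Red_1]$: $@_i@_as\ /\ @_is$. $[Red_2]$: $@_i@_at\ /\ @_at$. - $[\neg_1]$: $@_i\neg j\ /\ @_jj$. $[\neg_2]$: $@_a\neg b\ /\ @_bb$. - $[Id_1]$: $@_i@_a\varphi,\ @_ij\ /\ @_j@_a\varphi$. $[Id_2]$: $@_i@_a\varphi,\ @_ab\ /\ @_i@_b\varphi$. - $[Id'_1]$: $@_is,\ @_ij\ /\ @_js$. $[Id'_2]$: $@_at,\ @_ab\ /\ @_bt$. In $Red_1,Id'_1$: $s=k$ or $\neg k$ with $k\in\mathbf{Nom}_1$; in $Red_2,Id'_2$: $t=c$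 or $\neg c$ with $c\in\mathbf{Nom}_2$. One may also use $\square_n\varphi:=\neg\diamondsuit_n\neg\varphi$ with the (derived) rules $[\square_1]$: $@_i@_a\square_1\varphi,\ @_i\diamondsuit_1 j\ /\ @_j@_a\varphi$ and $[\square_2]$: $@_i@_a\square_2\varphi,\ @_a\diamondsuit_2 b\ /\ @_i@_b\varphi$. A branch $\Theta$ is closed if for some $\varphi,i,a$: $@_i@_a\varphi,@_i@_a\neg\varphi\in\Theta$, or $@_i\varphi,@_i\neg\varphi\in\Theta$, or $@_a\varphi,@_a\neg\varphi\in\Theta$. *)

theory Defs
  imports "HOL-Library.Countable" "HOL-Library.Infinite_Typeclass"
begin

text \<open>
  The set functions \<open>noms1\<close> and \<open>noms2\<close> give the nominals of either sort occurring in a formula,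
  including those used as indices of \<open>@\<close>.
\<close>

datatype (props: 'p, noms1: 'i, noms2: 'a) form =
    Prop 'p
  | Nom1 'i
  | Nom2 'a
  | Neg "('p, 'i, 'a) form"
  | Conj "('p, 'i, 'a) form" "('p, 'i, 'a) form"
  | Dia1 "('p, 'i, 'a) form"
  | Dia2 "('p, 'i, 'a) form"
  | At1 'i "('p, 'i, 'a) form"
  | At2 'a "('p, 'i, 'a) form"

definition root_formula :: "('p, 'i, 'a) form \<Rightarrow> bool" where
  "root_formula \<rho> \<longleftrightarrow>
     (\<exists>i a \<psi>. \<rho> = At1 i (At2 a \<psi>) \<and> i \<notin> noms1 \<psi> \<and> a \<notin> noms2 \<psi>)"

inductive literal1 :: "('p, 'i, 'a) form \<Rightarrow> bool" where
  "literal1 (Nom1 k)"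
| "literal1 (Neg (Nom1 k))"

inductive literal2 :: "('p, 'i, 'a) form \<Rightarrow> bool" where
  "literal2 (Nom2 c)"
| "literal2 (Neg (Nom2 c))"

text \<open>
  \<open>static_rule ps \<Delta>s\<close>: from the premises \<open>ps\<close>, the branch splits into one branch for each list in
  \<open>\<Delta>s\<close>, to which the formulas of that list are added.  These are all rules that do not introduce
  a new nominal.
\<close>

inductive static_rule :: "('p, 'i, 'a) form list \<Rightarrow> ('p, 'i, 'a) form list list \<Rightarrow> bool" where
  neg_neg: "static_rule [At1 i (At2 a (Neg (Neg \<phi>)))] [[At1 i (At2 a \<phi>)]]"
| conj: "static_rule [At1 i (At2 a (Conj \<phi> \<psi>))] [[At1 i (At2 a \<phi>), At1 i (At2 a \<psi>)]]"
| neg_conj: "static_rule [At1 i (At2 a (Neg (Conj \<phi> \<psi>)))]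
               [[At1 i (At2 a (Neg \<phi>))], [At1 i (At2 a (Neg \<psi>))]]"
| neg_dia1: "static_rule [At1 i (At2 a (Neg (Dia1 \<phi>))), At1 i (Dia1 (Nom1 j))]
               [[At1 j (At2 a (Neg \<phi>))]]"
| neg_dia2: "static_rule [At1 i (At2 a (Neg (Dia2 \<phi>))), At2 a (Dia2 (Nom2 b))]
               [[At1 i (At2 b (Neg \<phi>))]]"
| at1: "static_rule [At1 i (At2 a (At1 j \<phi>))] [[At1 j (At2 a \<phi>)]]"
| at2: "static_rule [At1 i (At2 a (At2 b \<phi>))] [[At1 i (At2 b \<phi>)]]"
| neg_at1: "static_rule [At1 i (At2 a (Neg (At1 j \<phi>)))] [[At1 j (At2 a (Neg \<phi>))]]"
| neg_at2: "static_rule [At1 i (At2 a (Neg (At2 b \<phi>)))] [[At1 i (At2 b (Neg \<phi>))]]"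
| red1: "literal1 s \<Longrightarrow> static_rule [At1 i (At2 a s)] [[At1 i s]]"
| red2: "literal2 t \<Longrightarrow> static_rule [At1 i (At2 a t)] [[At2 a t]]"
| neg1: "static_rule [At1 i (Neg (Nom1 j))] [[At1 j (Nom1 j)]]"
| neg2: "static_rule [At2 a (Neg (Nom2 b))] [[At2 b (Nom2 b)]]"
| id1: "static_rule [At1 i (At2 a \<phi>), At1 i (Nom1 j)] [[At1 j (At2 a \<phi>)]]"
| id2: "static_rule [At1 i (At2 a \<phi>), At2 a (Nom2 b)] [[At1 i (At2 b \<phi>)]]"
| id1': "literal1 s \<Longrightarrow> static_rule [At1 i s, At1 i (Nom1 j)] [[At1 j s]]"
| id2': "literal2 t \<Longrightarrow> static_rule [At2 a t, At2 a (Nom2 b)] [[At2 b t]]"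

text \<open>
  \<open>dia_rule \<Gamma> \<chi> \<Delta>\<close>: on a branch with set of formulas \<open>\<Gamma>\<close>, a diamond rule applied to \<open>\<chi>\<close> adds \<open>\<Delta>\<close>.
\<close>

inductive dia_rule ::
  "('p, 'i, 'a) form set \<Rightarrow> ('p, 'i, 'a) form \<Rightarrow> ('p, 'i, 'a) form list \<Rightarrow> bool"
  for \<Gamma> where
  dia1: "j \<notin> (\<Union>\<phi>\<in>\<Gamma>. noms1 \<phi>) \<Longrightarrow>
     dia_rule \<Gamma> (At1 i (At2 a (Dia1 \<phi>))) [At1 i (Dia1 (Nom1 j)), At1 j (At2 a \<phi>)]"
| dia2: "b \<notin> (\<Union>\<phi>\<in>\<Gamma>. noms2 \<phi>) \<Longrightarrow>
     dia_rule \<Gamma> (At1 i (At2 a (Dia2 \<phi>))) [At2 a (Dia2 (Nom2 b)), At1 i (At2 b \<phi>)]"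

text \<open>
  A node carries its formula and, if it was added by a diamond rule, the formula to which that
  rule was applied.  The second component records the history needed to state that a diamond rule
  is applied exactly once to each formula of a branch.
\<close>

type_synonym ('p, 'i, 'a) node = "('p, 'i, 'a) form \<times> ('p, 'i, 'a) form option"

definition forms :: "('p, 'i, 'a) node set \<Rightarrow> ('p, 'i, 'a) form set" where
  "forms N = fst ` N"

definition expanded :: "('p, 'i, 'a) node set \<Rightarrow> ('p, 'i, 'a) form set" where
  "expanded N = {\<chi>. Some \<chi> \<in> snd ` N}"

definition closed_branch :: "('p, 'i, 'a) node set \<Rightarrow> bool" where
  "closed_branch N \<longleftrightarrow>
     (\<exists>i a \<phi>. At1 i (At2 a \<phi>) \<in> forms N \<and> At1 i (At2 a (Neg \<phi>)) \<in> forms N) \<or>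
     (\<exists>i \<phi>. At1 i \<phi> \<in> forms N \<and> At1 i (Neg \<phi>) \<in> forms N) \<or>
     (\<exists>a \<phi>. At2 a \<phi> \<in> forms N \<and> At2 a (Neg \<phi>) \<in> forms N)"

text \<open>
  No rule application can contribute to the branch any more.  For the branching rule this means
  that one of its alternatives is already present.
\<close>

definition saturated :: "('p, 'i, 'a) node set \<Rightarrow> bool" where
  "saturated N \<longleftrightarrow>
     (\<forall>ps \<Delta>s. static_rule ps \<Delta>s \<longrightarrow> set ps \<subseteq> forms N \<longrightarrow> (\<exists>\<Delta>\<in>set \<Delta>s. set \<Delta> \<subseteq> forms N)) \<and>
     (\<forall>i a \<phi>. At1 i (At2 a (Dia1 \<phi>)) \<in> forms N \<longrightarrow> At1 i (At2 a (Dia1 \<phi>)) \<in> expanded N) \<and>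
     (\<forall>i a \<phi>. At1 i (At2 a (Dia2 \<phi>)) \<in> forms N \<longrightarrow> At1 i (At2 a (Dia2 \<phi>)) \<in> expanded N)"

text \<open>
  \<open>step B Ns\<close>: one rule application at the end of the finite branch \<open>B\<close> continues it by the
  (nonempty) lists of nodes in \<open>Ns\<close>, one for each alternative.  Formulas already on \<open>B\<close> are not
  added again.
\<close>

inductive step :: "('p, 'i, 'a) node list \<Rightarrow> ('p, 'i, 'a) node list list \<Rightarrow> bool" for B where
  static: "\<lbrakk>static_rule ps \<Delta>s; set ps \<subseteq> forms (set B); \<forall>\<Delta>\<in>set \<Delta>s. \<not> set \<Delta> \<subseteq> forms (set B)\<rbrakk> \<Longrightarrow>
     step B (map (\<lambda>\<Delta>. map (\<lambda>\<phi>. (\<phi>, None)) (remdups (filter (\<lambda>\<phi>. \<phi> \<notin> forms (set B)) \<Delta>))) \<Delta>s)"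
| dia: "\<lbrakk>\<chi> \<in> forms (set B); \<chi> \<notin> expanded (set B); dia_rule (forms (set B)) \<chi> \<Delta>\<rbrakk> \<Longrightarrow>
     step B [map (\<lambda>\<phi>. (\<phi>, Some \<chi>)) \<Delta>]"

text \<open>Possibly infinite, finitely branching ordered trees of nodes.\<close>

codatatype ('p, 'i, 'a) tree =
  Node (content: "('p, 'i, 'a) node") (children: "('p, 'i, 'a) tree list")

definition chain ::
  "('p, 'i, 'a) node list \<Rightarrow> ('p, 'i, 'a) tree list \<Rightarrow> ('p, 'i, 'a) tree list" where
  "chain N ts = foldr (\<lambda>x us. [Node x us]) N ts"

text \<open>
  \<open>grows B ts\<close>: the trees \<open>ts\<close> attached below the finite branch \<open>B\<close> arise by applying rules, and no
  branch ends before it is closed or saturated.  In \<open>extend\<close>, each alternative \<open>Ns ! n\<close> becomes a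
  non-branching chain of nodes, below which the construction goes on with \<open>tss ! n\<close>.
\<close>

coinductive grows :: "('p, 'i, 'a) node list \<Rightarrow> ('p, 'i, 'a) tree list \<Rightarrow> bool" where
  stop: "closed_branch (set B) \<or> saturated (set B) \<Longrightarrow> grows B []"
| extend: "\<lbrakk>\<not> closed_branch (set B); step B Ns; length tss = length Ns;
            \<forall>n<length Ns. grows (B @ Ns ! n) (tss ! n)\<rbrakk> \<Longrightarrow>
     grows B (concat (map2 chain Ns tss))"

text \<open>
  An infinite path from the root, given by the subtrees at its nodes; it is automatically maximal.
\<close>

definition infinite_branch :: "('p, 'i, 'a) tree \<Rightarrow> (nat \<Rightarrow> ('p, 'i, 'a) tree) \<Rightarrow> bool" where
  "infinite_branch T b \<longleftrightarrow> b 0 = T \<and> (\<forall>n. b (Suc n) \<in> set (children (b n)))"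

text \<open>
  The last condition says that rules are applied as often as possible on infinite branches, too:
  no applicable rule is postponed forever.
\<close>

definition tableau :: "('p, 'i, 'a) form \<Rightarrow> ('p, 'i, 'a) tree \<Rightarrow> bool" where
  "tableau \<rho> T \<longleftrightarrow>
     root_formula \<rho> \<and>
     content T = (\<rho>, None) \<and>
     grows [(\<rho>, None)] (children T) \<and>
     (\<forall>b. infinite_branch T b \<longrightarrow> saturated (range (\<lambda>n. content (b n))))"

end

theory Submission
  imports Defs "HOL-Library.Sublist"
begin

text \<open>
  Let \<open>\<box>\<close> abbreviate \<open>\<not>\<diamond>\<not>\<close>.  The root formula is
  \<open>@\<^sub>i @\<^sub>a (\<box>\<^sub>2\<diamond>\<^sub>1p \<and> (\<box>\<^sub>1\<diamond>\<^sub>2p \<and> \<diamond>\<^sub>1p))\<close>.  Diamond facts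
  \<open>@\<^sub>i\<diamond>\<^sub>1j\<close> and \<open>@\<^sub>a\<diamond>\<^sub>2b\<close> do not mention the other sort, so each new successor is visible from
  the whole row or column, and the two boxes feed each other for ever.  Every new successor \<open>j\<close> of
  \<open>i\<close> makes \<open>\<box>\<^sub>1\<diamond>\<^sub>2p\<close> demand \<open>@\<^sub>j @\<^sub>a \<diamond>\<^sub>2p\<close>, which creates a new successor \<open>b\<close> of \<open>a\<close>;
  and then \<open>\<box>\<^sub>2\<diamond>\<^sub>1p\<close> demands \<open>@\<^sub>i @\<^sub>b \<diamond>\<^sub>1p\<close>, which creates a further successor of
  \<open>i\<close>.  Modal depth does not bound the process, because both boxes stay at the root pair \<open>(i, a)\<close>
  while that pair acquires more and more successors.

  None of the rules used splits the branch, so the tableau is a single infinite path.  The rules are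
  applied in rounds, each of which meets all the demands left by the round before; hence no
  rule application is postponed for ever (\<open>saturated_limit\<close>).  The only
  negated formulas that arise are the boxes and double negations, and what they negate never
  occurs at the same pair, so the branch stays open (\<open>open_limit\<close>).  The passage from such a sequence of finite branches to a
  tableau, by coinduction, is \<open>tableau_of_linear_run\<close>.
\<close>

section \<open>Tableaux without splitting\<close>

text \<open>One rule application that does not split the branch.\<close>

definition extends :: "('p, 'i, 'a) node list \<Rightarrow> ('p, 'i, 'a) node list \<Rightarrow> bool" where
  "extends B C \<longleftrightarrow> (\<exists>E. E \<noteq> [] \<and> C = B @ E \<and> step B [E])"

lemma forms_insert: "forms (insert x N) = insert (fst x) (forms N)"
  by (simp add: forms_def)

lemma expanded_insert: "expanded (insert x N) = set_option (snd x) \<union> expanded N"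
  by (auto simp: expanded_def)

lemma extends_static:
  assumes "static_rule ps [\<Delta>]" "set ps \<subseteq> forms (set B)"
    and "\<Delta> \<noteq> []" "distinct \<Delta>" "\<forall>\<phi>\<in>set \<Delta>. \<phi> \<notin> forms (set B)"
  shows "extends B (B @ map (\<lambda>\<phi>. (\<phi>, None)) \<Delta>)"
proof -
  have "filter (\<lambda>\<phi>. \<phi> \<notin> forms (set B)) \<Delta> = \<Delta>"
    using assms(5) by simp
  moreover have "\<not> set \<Delta> \<subseteq> forms (set B)"
    using assms(3,5) by (cases \<Delta>) auto
  ultimately show ?thesis
    using step.static[OF assms(1,2)] assms(3,4) by (auto simp: extends_def distinct_remdups_id)
qed

lemma extends_dia:
  assumes "\<chi> \<in> forms (set B)" "\<chi> \<notin> expanded (set B)" "dia_rule (forms (set B)) \<chi> \<Delta>"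
  shows "extends B (B @ map (\<lambda>\<phi>. (\<phi>, Some \<chi>)) \<Delta>)"
proof -
  have "\<Delta> \<noteq> []"
    using assms(3) by (auto elim: dia_rule.cases)
  then show ?thesis
    using step.dia[OF assms] by (auto simp: extends_def)
qed

lemma prefix_if_extends_rtranclp:
  assumes "extends\<^sup>*\<^sup>* B C"
  shows "prefix B C"
  using assms by induction (auto simp: extends_def)

lemma length_less_if_extends_tranclp:
  assumes "extends\<^sup>+\<^sup>+ B C"
  shows "length B < length C"
  using assms by induction (auto simp: extends_def)

lemma closed_branch_mono:
  assumes "closed_branch M" "M \<subseteq> N"
  shows "closed_branch N"
proof -
  have "forms M \<subseteq> forms N"
    using assms(2) by (auto simp: forms_def)
  then show ?thesis
    using assms(1) unfolding closed_branch_def by blast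
qed

primcorec path_tree :: "(nat \<Rightarrow> ('p, 'i, 'a) node) \<Rightarrow> nat \<Rightarrow> ('p, 'i, 'a) tree" where
  "path_tree x k = Node (x k) [path_tree x (Suc k)]"

lemma chain_path_tree:
  "chain (map x [k..<k + l]) [path_tree x (k + l)] = [path_tree x k]"
proof (induction l arbitrary: k)
  case 0
  then show ?case by (simp add: chain_def)
next
  case (Suc l)
  have "[k..<k + Suc l] = k # [Suc k..<Suc k + l]"
    by (simp add: upt_conv_Cons del: upt_Suc)
  then show ?case
    using Suc[of "Suc k"] path_tree.code[of x k] by (simp add: chain_def del: upt_Suc)
qed

lemma infinite_branch_path_tree_iff:
  "infinite_branch (path_tree x 0) b \<longleftrightarrow> b = path_tree x"
proof
  assume b: "infinite_branch (path_tree x 0) b"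
  have "b n = path_tree x n" for n
  proof (induction n)
    case (Suc n)
    have "b (Suc n) \<in> set (children (b n))"
      using b by (simp add: infinite_branch_def)
    then show ?case using Suc by simp
  qed (use b in \<open>simp add: infinite_branch_def\<close>)
  then show "b = path_tree x" by auto
qed (simp add: infinite_branch_def)

text \<open>
  The finite branches \<open>Bs n\<close> need only be milestones: any number of rule applications may lie
  between two of them.  The coinduction runs over all intermediate branches, each of which can be
  continued because it still has some milestone strictly ahead.
\<close>

lemma tableau_of_linear_run:
  fixes Bs :: "nat \<Rightarrow> ('p, 'i, 'a) node list"
  assumes root: "root_formula \<rho>"
    and start: "extends\<^sup>*\<^sup>* [(\<rho>, None)] (Bs 0)"
    and progress: "\<And>n. extends\<^sup>+\<^sup>+ (Bs n) (Bs (Suc n))"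
    and not_closed: "\<not> closed_branch (\<Union>n. set (Bs n))"
    and sat: "saturated (\<Union>n. set (Bs n))"
  shows "\<exists>T. tableau \<rho> T \<and> (\<exists>b. infinite_branch T b)"
proof -
  have Bs_mono: "prefix (Bs m) (Bs n)" if "m \<le> n" for m n
    using that
  proof (induction n rule: dec_induct)
    case (step n)
    then show ?case
      using prefix_if_extends_rtranclp[OF tranclp_into_rtranclp[OF progress[of n]]]
      by (meson prefix_order.trans)
  qed simp
  have Bs_len: "k < length (Bs k)" for k
  proof (induction k)
    case 0
    show ?case using prefix_if_extends_rtranclp[OF start] by (auto simp: prefix_def)
  next
    case (Suc k)
    then show ?case using length_less_if_extends_tranclp[OF progress[of k]] by simp
  qed
  define x where "x k = Bs k ! k" for k
  have Bs_nth: "Bs n ! k = x k" if "k < length (Bs n)" for n k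
    using Bs_mono[of n k] Bs_mono[of k n] that Bs_len[of k] unfolding x_def
    by (metis nle_le nth_append prefix_def)
  have prefix_eq: "B = map x [0..<length B]" if "prefix B (Bs n)" for B n
  proof (rule nth_equalityI)
    fix k assume k: "k < length B"
    then have "B ! k = Bs n ! k" "k < length (Bs n)"
      using that by (auto simp: prefix_def nth_append)
    then show "B ! k = map x [0..<length B] ! k"
      using k Bs_nth by simp
  qed simp
  have x_0: "x 0 = (\<rho>, None)"
    using prefix_if_extends_rtranclp[OF start] by (auto simp: x_def prefix_def)
  have range_x: "range x = (\<Union>n. set (Bs n))"
  proof
    show "range x \<subseteq> (\<Union>n. set (Bs n))"
      using nth_mem[OF Bs_len] by (auto simp: x_def)
    show "(\<Union>n. set (Bs n)) \<subseteq> range x"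
    proof
      fix y assume "y \<in> (\<Union>n. set (Bs n))"
      then obtain n k where "k < length (Bs n)" "y = Bs n ! k"
        by (auto simp: in_set_conv_nth)
      then show "y \<in> range x" using Bs_nth by simp
    qed
  qed
  have "grows B [path_tree x (length B)]" if "extends\<^sup>*\<^sup>* B (Bs n)" for B n
    using that
  proof (coinduction arbitrary: B n)
    case grows
    have "extends\<^sup>+\<^sup>+ B (Bs (Suc n))"
      using grows progress[of n] by (rule rtranclp_tranclp_tranclp)
    then obtain C where C: "extends B C" "extends\<^sup>*\<^sup>* C (Bs (Suc n))"
      by (meson tranclpD)
    then obtain E where E: "C = B @ E" "step B [E]"
      by (auto simp: extends_def)
    have "set B \<subseteq> (\<Union>n. set (Bs n))"
      using set_mono_prefix[OF prefix_if_extends_rtranclp[OF grows]] by blast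
    then have "\<not> closed_branch (set B)"
      using not_closed closed_branch_mono by blast
    moreover have "chain E [path_tree x (length C)] = [path_tree x (length B)]"
    proof -
      have "C = map x [0..<length C]"
        using prefix_eq[OF prefix_if_extends_rtranclp[OF C(2)]] .
      then have "E = drop (length B) (map x [0..<length C])"
        using E(1) by (metis append_eq_conv_conj)
      then have "E = map x [length B..<length B + length E]"
        using E(1) by (simp add: drop_map)
      then show ?thesis
        using chain_path_tree[of x "length B" "length E"] E(1) by simp
    qed
    ultimately show ?case
      using E C(2)
      by (intro disjI2 exI[of _ B] exI[of _ "[E]"] exI[of _ "[[path_tree x (length C)]]"]) auto
  qed
  from this[OF start] have "tableau \<rho> (path_tree x 0)"
    using root x_0 range_x sat by (simp add: tableau_def infinite_branch_path_tree_iff)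
  then show ?thesis
    using infinite_branch_path_tree_iff by blast
qed

section \<open>The two mutually feeding boxes\<close>

text \<open>
  The nominals \<open>u 0\<close> and \<open>w 0\<close> name the root pair, and \<open>u (Suc n)\<close> and \<open>w (Suc n)\<close> are the ones
  introduced in round \<open>n\<close>.
\<close>

locale feeding_boxes =
  fixes p :: 'p and u :: "nat \<Rightarrow> 'i" and w :: "nat \<Rightarrow> 'a"
  assumes inj_u: "inj u" and inj_w: "inj w"
begin

abbreviation holds :: "nat \<Rightarrow> nat \<Rightarrow> ('p, 'i, 'a) form \<Rightarrow> ('p, 'i, 'a) form" where
  "holds k l \<phi> \<equiv> At1 (u k) (At2 (w l) \<phi>)"

abbreviation D1 :: "('p, 'i, 'a) form" where "D1 \<equiv> Dia1 (Prop p)"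
abbreviation D2 :: "('p, 'i, 'a) form" where "D2 \<equiv> Dia2 (Prop p)"
abbreviation Box2_D1 :: "('p, 'i, 'a) form" where "Box2_D1 \<equiv> Neg (Dia2 (Neg D1))"
abbreviation Box1_D2 :: "('p, 'i, 'a) form" where "Box1_D2 \<equiv> Neg (Dia1 (Neg D2))"

definition seed :: "('p, 'i, 'a) form" where
  "seed = holds 0 0 (Conj Box2_D1 (Conj Box1_D2 D1))"

definition initial_nodes :: "('p, 'i, 'a) node list" where
  "initial_nodes =
     [(seed, None), (holds 0 0 Box2_D1, None), (holds 0 0 (Conj Box1_D2 D1), None),
      (holds 0 0 Box1_D2, None), (holds 0 0 D1, None)]"

definition round_nodes :: "nat \<Rightarrow> ('p, 'i, 'a) node list" where
  "round_nodes n =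
     [(At1 (u 0) (Dia1 (Nom1 (u (Suc n)))), Some (holds 0 n D1)),
      (holds (Suc n) n (Prop p), Some (holds 0 n D1)),
      (holds (Suc n) 0 (Neg (Neg D2)), None),
      (holds (Suc n) 0 D2, None),
      (At2 (w 0) (Dia2 (Nom2 (w (Suc n)))), Some (holds (Suc n) 0 D2)),
      (holds (Suc n) (Suc n) (Prop p), Some (holds (Suc n) 0 D2)),
      (holds 0 (Suc n) (Neg (Neg D1)), None),
      (holds 0 (Suc n) D1, None)]"

definition branch :: "nat \<Rightarrow> ('p, 'i, 'a) node list" where
  "branch n = initial_nodes @ concat (map round_nodes [0..<n])"

lemma u_eq_iff [simp]: "u k = u l \<longleftrightarrow> k = l"
  using inj_u by (simp add: inj_eq)

lemma w_eq_iff [simp]: "w k = w l \<longleftrightarrow> k = l"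
  using inj_w by (simp add: inj_eq)

lemma root_formula_seed: "root_formula seed"
  by (simp add: root_formula_def seed_def)

lemma extends_initial_nodes: "extends\<^sup>*\<^sup>* [(seed, None)] (branch 0)"
proof -
  let ?B0 = "[(seed, None)] :: ('p, 'i, 'a) node list"
  let ?\<Delta>1 = "[holds 0 0 Box2_D1, holds 0 0 (Conj Box1_D2 D1)]"
  let ?B1 = "?B0 @ map (\<lambda>\<phi>. (\<phi>, None)) ?\<Delta>1"
  let ?\<Delta>2 = "[holds 0 0 Box1_D2, holds 0 0 D1]"
  let ?B2 = "?B1 @ map (\<lambda>\<phi>. (\<phi>, None)) ?\<Delta>2"
  have "extends ?B0 ?B1"
    by (rule extends_static, rule static_rule.conj) (auto simp: forms_def seed_def)
  moreover have "extends ?B1 ?B2"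
    by (rule extends_static, rule static_rule.conj) (auto simp: forms_def seed_def)
  moreover have "branch 0 = ?B2"
    by (simp add: branch_def initial_nodes_def)
  ultimately show ?thesis by simp
qed

lemma forms_initial_nodes:
  "forms (set initial_nodes) =
     {seed, holds 0 0 Box2_D1, holds 0 0 (Conj Box1_D2 D1), holds 0 0 Box1_D2, holds 0 0 D1}"
  by (simp add: initial_nodes_def forms_def)

lemma forms_round_nodes:
  "forms (set (round_nodes n)) =
     {At1 (u 0) (Dia1 (Nom1 (u (Suc n)))), holds (Suc n) n (Prop p),
      holds (Suc n) 0 (Neg (Neg D2)), holds (Suc n) 0 D2,
      At2 (w 0) (Dia2 (Nom2 (w (Suc n)))), holds (Suc n) (Suc n) (Prop p),
      holds 0 (Suc n) (Neg (Neg D1)), holds 0 (Suc n) D1}"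
  by (simp add: round_nodes_def forms_def)

lemma expanded_round_nodes:
  "expanded (set (round_nodes n)) = {holds 0 n D1, holds (Suc n) 0 D2}"
  by (auto simp: round_nodes_def expanded_def)

lemma forms_branch:
  "forms (set (branch n)) = forms (set initial_nodes) \<union> (\<Union>k<n. forms (set (round_nodes k)))"
  by (auto simp: branch_def forms_def)

lemma expanded_branch: "expanded (set (branch n)) = (\<Union>k<n. {holds 0 k D1, holds (Suc k) 0 D2})"
proof -
  have "expanded (set (branch n)) = (\<Union>k<n. expanded (set (round_nodes k)))"
    by (force simp: branch_def initial_nodes_def expanded_def)
  then show ?thesis by (simp only: expanded_round_nodes)
qed

lemma D1_in_branch: "holds 0 n D1 \<in> forms (set (branch n))"
  by (cases n) (auto simp: forms_branch forms_initial_nodes forms_round_nodes)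

text \<open>
  The box \<open>Box1_D2\<close> reacts to the successor \<open>u (Suc n)\<close> created by the pending formula
  \<open>holds 0 n D1\<close>, and \<open>Box2_D1\<close> to the successor \<open>w (Suc n)\<close> created in response; this leaves
  \<open>holds 0 (Suc n) D1\<close> pending for the next round.
\<close>

lemma extends_round: "extends\<^sup>+\<^sup>+ (branch n) (branch (Suc n))"
proof -
  let ?none = "map (\<lambda>\<phi>. (\<phi>, None))"
  let ?B0 = "branch n"
  let ?B1 = "?B0 @ map (\<lambda>\<phi>. (\<phi>, Some (holds 0 n D1)))
                     [At1 (u 0) (Dia1 (Nom1 (u (Suc n)))), holds (Suc n) n (Prop p)]"
  let ?B2 = "?B1 @ ?none [holds (Suc n) 0 (Neg (Neg D2))]"
  let ?B3 = "?B2 @ ?none [holds (Suc n) 0 D2]"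
  let ?B4 = "?B3 @ map (\<lambda>\<phi>. (\<phi>, Some (holds (Suc n) 0 D2)))
                     [At2 (w 0) (Dia2 (Nom2 (w (Suc n)))), holds (Suc n) (Suc n) (Prop p)]"
  let ?B5 = "?B4 @ ?none [holds 0 (Suc n) (Neg (Neg D1))]"
  let ?B6 = "?B5 @ ?none [holds 0 (Suc n) D1]"
  note content = forms_insert forms_branch forms_initial_nodes forms_round_nodes seed_def
  have B1: "extends ?B0 ?B1"
    by (rule extends_dia[OF D1_in_branch], simp add: expanded_branch, rule dia_rule.dia1)
      (auto simp: content)
  have B2: "extends ?B1 ?B2"
    by (rule extends_static, rule static_rule.neg_dia1[where i = "u 0"]) (auto simp: content)
  have B3: "extends ?B2 ?B3"
    by (rule extends_static, rule static_rule.neg_neg) (auto simp: content)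
  have B4: "extends ?B3 ?B4"
    by (rule extends_dia, simp add: forms_insert,
        simp add: expanded_insert expanded_branch, rule dia_rule.dia2)
      (auto simp: content)
  have B5: "extends ?B4 ?B5"
    by (rule extends_static, rule static_rule.neg_dia2[where a = "w 0"]) (auto simp: content)
  have B6: "extends ?B5 ?B6"
    by (rule extends_static, rule static_rule.neg_neg) (auto simp: content)
  have "extends\<^sup>+\<^sup>+ ?B0 ?B6"
    using tranclp.r_into_trancl[of extends, OF B1]
    by (intro tranclp.trancl_into_trancl[of extends, OF _ B6]
        tranclp.trancl_into_trancl[of extends, OF _ B5]
        tranclp.trancl_into_trancl[of extends, OF _ B4]
        tranclp.trancl_into_trancl[of extends, OF _ B3]
        tranclp.trancl_into_trancl[of extends, OF _ B2])
  moreover have "?B6 = branch (Suc n)"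
    by (simp add: branch_def round_nodes_def)
  ultimately show ?thesis by (simp only:)
qed

definition limit :: "('p, 'i, 'a) node set" where
  "limit = (\<Union>n. set (branch n))"

lemma forms_limit: "forms limit = forms (set initial_nodes) \<union> (\<Union>n. forms (set (round_nodes n)))"
proof -
  have "forms limit = (\<Union>n. forms (set (branch n)))"
    by (auto simp: limit_def forms_def)
  then show ?thesis by (auto simp: forms_branch)
qed

lemma expanded_limit: "expanded limit = (\<Union>n. {holds 0 n D1, holds (Suc n) 0 D2})"
proof -
  have "expanded limit = (\<Union>n. expanded (set (branch n)))"
    by (auto simp: limit_def expanded_def)
  then show ?thesis by (auto simp: expanded_branch)
qed

text \<open>
  The initially pending formula \<open>holds 0 0 D1\<close> and those left pending by the rounds form the single
  family \<open>holds 0 n D1\<close>.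
\<close>

lemma mem_forms_limit_iff:
  "\<phi> \<in> forms limit \<longleftrightarrow>
     \<phi> \<in> {seed, holds 0 0 Box2_D1, holds 0 0 (Conj Box1_D2 D1), holds 0 0 Box1_D2} \<or>
     (\<exists>n. \<phi> \<in> {holds 0 n D1, At1 (u 0) (Dia1 (Nom1 (u (Suc n)))), holds (Suc n) n (Prop p),
       holds (Suc n) 0 (Neg (Neg D2)), holds (Suc n) 0 D2, At2 (w 0) (Dia2 (Nom2 (w (Suc n)))),
       holds (Suc n) (Suc n) (Prop p), holds 0 (Suc n) (Neg (Neg D1))})"
proof -
  have "(\<exists>n. \<phi> = holds 0 n D1) \<longleftrightarrow> \<phi> = holds 0 0 D1 \<or> (\<exists>n. \<phi> = holds 0 (Suc n) D1)"
    by (metis not0_implies_Suc)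
  then show ?thesis
    unfolding forms_limit forms_initial_nodes forms_round_nodes
    by (simp add: ex_disj_distrib disj_ac)
qed

lemma open_limit: "\<not> closed_branch limit"
  unfolding closed_branch_def mem_forms_limit_iff seed_def by auto

text \<open>
  No nominal is ever asserted or denied, so the reduction and identity rules do not apply.  The
  diamond facts \<open>At1 (u 0) (Dia1 (Nom1 (u (Suc n))))\<close> and \<open>At2 (w 0) (Dia2 (Nom2 (w (Suc n))))\<close>
  carry only one satisfaction operator, so they call for no witness of their own.  The boxes sit at
  the root pair only, and their conclusion for a successor was added in the round that created it.
\<close>

lemma saturated_limit: "saturated limit"
  unfolding saturated_def
proof (intro conjI allI impI)
  fix ps and \<Delta>s :: "('p, 'i, 'a) form list list"
  assume "static_rule ps \<Delta>s" "set ps \<subseteq> forms limit"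
  then show "\<exists>\<Delta>\<in>set \<Delta>s. set \<Delta> \<subseteq> forms limit"
    by cases (auto simp: mem_forms_limit_iff seed_def elim: literal1.cases literal2.cases)
next
  fix i a \<phi>
  assume "At1 i (At2 a (Dia1 \<phi>)) \<in> forms limit"
  then show "At1 i (At2 a (Dia1 \<phi>)) \<in> expanded limit"
    by (auto simp: mem_forms_limit_iff seed_def expanded_limit)
next
  fix i a \<phi>
  assume "At1 i (At2 a (Dia2 \<phi>)) \<in> forms limit"
  then show "At1 i (At2 a (Dia2 \<phi>)) \<in> expanded limit"
    by (auto simp: mem_forms_limit_iff seed_def expanded_limit)
qed

lemma ex_tableau_seed: "\<exists>T. tableau seed T \<and> (\<exists>b. infinite_branch T b)"
  using tableau_of_linear_run[OF root_formula_seed extends_initial_nodes extends_round]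
    open_limit saturated_limit
  by (simp add: limit_def)

end

theorem proposition7p1:
  shows "\<exists>\<rho> :: ('p::countable, 'i::{countable,infinite}, 'a::{countable,infinite}) form.
           root_formula \<rho> \<and> (\<exists>T. tableau \<rho> T \<and> (\<exists>b. infinite_branch T b))"
proof -
  obtain u :: "nat \<Rightarrow> 'i" where "inj u"
    using infinite_countable_subset[OF infinite_UNIV] by blast
  moreover obtain w :: "nat \<Rightarrow> 'a" where "inj w"
    using infinite_countable_subset[OF infinite_UNIV] by blast
  \<comment> \<open>Any propositional variable can serve as \<open>p\<close>; its type only has to be nonempty.\<close>
  ultimately interpret feeding_boxes "undefined :: 'p" u w
    by unfold_locales
  show ?thesis
    using root_formula_seed ex_tableau_seed by blast
qed

end
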